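(* Let $v_1, v_2, \dots, v_n$ be real numbers such that $\sum_{i=1}^n v_i^2 \le 1$. Let $a_1, a_2, \dots, a_n$ be independent random signs. Let $S = \sum_{i=1}^n a_i v_i$. Then \[ \Pr[\, |S| \le 1 \,] > 0.427685 . \]
   Context: A random sign is a random variable whose probability distribution is the uniform distribution on the set $\{-1, +1\}$. $\Pr[A]$ denotes the probability of an event $A$. *)

theory Defs
  imports "HOL-Probability.Probability"
begin

text \<open>The uniform law on the two-point set is pushed forward along the inclusion into the reals,
  so that both sides of the equation are Borel measures on the real line.  Consequently the values
  of a random sign lie in the two-point set almost surely, not necessarily pointwise.\<close>

definition random_sign :: "'a measure \<Rightarrow> ('a \<Rightarrow> real) \<Rightarrow> bool" where
  "random_sign M X \<longleftrightarrow>
     X \<in> borel_measurable M \<and>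
     distr M borel X = distr (uniform_count_measure {-1, 1}) borel (\<lambda>x. x)"

end

theory Submission
  imports Defs
begin

text \<open>Add the signed terms one at a time, always choosing a term that cannot push the partial sum
  \<open>m\<close> out of \<open>[-1, 1]\<close>, and stop when no remaining term has this property.  If terms are left when
  the walk stops at \<open>m \<ge> 0\<close> with remainder \<open>Y\<close>, symmetry of \<open>Y\<close> bounds the conditional probability
  of \<open>\<bar>S\<bar> > 1\<close> by \<open>1/2 + Pr(Y > 1 + m)\<close>.  With \<open>T\<close> the sum of the squares already used, \<open>m\<^sup>2 - T\<close> is a
  martingale starting at 0, so it suffices to find a constant \<open>l\<close> such that
  \<open>Pr(Y > 1 + m) + l (T - m\<^sup>2) \<le> 0.0723\<close> at every stopping state.

  If all \<open>\<bar>v i\<bar> \<le> 1/4\<close>, the walk stops at \<open>m > 3/4\<close> and Chebyshev's inequality suffices.  Otherwise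
  start with the largest term, so that \<open>T \<ge> 1/16\<close>.  For \<open>m \<ge> 3/4\<close> the fourth moment suffices.  For
  \<open>m < 3/4\<close> all the remaining terms exceed 1/4 but are at most \<open>sqrt T\<close>, hence there are at most
  14 of them, and by Cauchy-Schwarz \<open>Y > 1 + m\<close> only allows few negative signs.\<close>

section \<open>Averages over all sign patterns, and their moments\<close>

text \<open>The set \<open>B\<close> collects the indices with sign \<open>-1\<close>.\<close>

definition sign_avg :: "('i \<Rightarrow> real) \<Rightarrow> 'i set \<Rightarrow> (real \<Rightarrow> real) \<Rightarrow> real" where
  "sign_avg v A f = (\<Sum>B\<in>Pow A. f (sum v A - 2 * sum v B)) / 2 ^ card A"

lemma sign_avg_empty [simp]: "sign_avg v {} f = f 0"
  by (simp add: sign_avg_def)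

text \<open>Conditioning on one sign: sets of negative indices that omit or contain \<open>i\<close>
  add or subtract \<open>v i\<close>. Every induction on the index set rests on this.\<close>

lemma sign_avg_insert:
  assumes "finite A" "i \<notin> A"
  shows "sign_avg v (insert i A) f =
    (sign_avg v A (\<lambda>s. f (s + v i)) + sign_avg v A (\<lambda>s. f (s - v i))) / 2"
proof -
  let ?g = "\<lambda>B. f (sum v (insert i A) - 2 * sum v B)"
  have "sum ?g (Pow (insert i A)) = sum ?g (Pow A) + sum ?g (insert i ` Pow A)"
    unfolding Pow_insert using assms by (intro sum.union_disjoint) auto
  also have "sum ?g (Pow A) = (\<Sum>B\<in>Pow A. f (sum v A - 2 * sum v B + v i))"
    using assms by (intro sum.cong) (auto simp: algebra_simps)
  also have "sum ?g (insert i ` Pow A) = (\<Sum>B\<in>Pow A. ?g (insert i B))"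
    using assms by (subst sum.reindex) (auto simp: inj_on_def)
  also have "\<dots> = (\<Sum>B\<in>Pow A. f (sum v A - 2 * sum v B - v i))"
  proof (intro sum.cong refl)
    fix B assume "B \<in> Pow A"
    then have "finite B" "i \<notin> B" using assms finite_subset by auto
    then show "?g (insert i B) = f (sum v A - 2 * sum v B - v i)"
      using assms by (simp add: algebra_simps)
  qed
  finally show ?thesis
    using assms by (simp add: sign_avg_def add_divide_distrib)
qed

lemma sign_avg_mono:
  assumes "\<And>s. f s \<le> g s"
  shows "sign_avg v A f \<le> sign_avg v A g"
  unfolding sign_avg_def by (intro divide_right_mono sum_mono assms) auto

lemma sign_avg_add: "sign_avg v A (\<lambda>s. f s + g s) = sign_avg v A f + sign_avg v A g"
  by (simp add: sign_avg_def sum.distrib add_divide_distrib)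

lemma sign_avg_cmult: "sign_avg v A (\<lambda>s. c * f s) = c * sign_avg v A f"
  by (simp add: sign_avg_def sum_distrib_left)

lemma sign_avg_const: "finite A \<Longrightarrow> sign_avg v A (\<lambda>s. c) = c"
  by (simp add: sign_avg_def card_Pow)

lemma sign_avg_minus:
  "finite A \<Longrightarrow> sign_avg v A (\<lambda>s. f (- s)) = sign_avg v A f"
proof (induction A arbitrary: f rule: finite_induct)
  case (insert i A)
  show ?case
    using insert.hyps insert.IH[of "\<lambda>s. f (s - v i)"] insert.IH[of "\<lambda>s. f (s + v i)"]
    by (simp add: sign_avg_insert algebra_simps)
qed simp

lemma sign_avg_abs:
  "finite A \<Longrightarrow> sign_avg (\<lambda>i. \<bar>v i\<bar>) A f = sign_avg v A f"
proof (induction A arbitrary: f rule: finite_induct)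
  case (insert i A)
  then show ?case by (cases "v i \<ge> 0") (simp_all add: sign_avg_insert)
qed simp

lemma sign_avg_power2:
  "finite A \<Longrightarrow> sign_avg v A (\<lambda>s. s\<^sup>2) = (\<Sum>i\<in>A. (v i)\<^sup>2)"
proof (induction A rule: finite_induct)
  case (insert i A)
  have "sign_avg v (insert i A) (\<lambda>s. s\<^sup>2)
      = (sign_avg v A (\<lambda>s. (s + v i)\<^sup>2) + sign_avg v A (\<lambda>s. (s - v i)\<^sup>2)) / 2"
    using insert.hyps by (rule sign_avg_insert)
  also have "\<dots> = sign_avg v A (\<lambda>s. 2 * s\<^sup>2 + 2 * (v i)\<^sup>2) / 2"
    unfolding sign_avg_add[symmetric] by (simp add: power2_eq_square algebra_simps)
  also have "\<dots> = (\<Sum>i\<in>A. (v i)\<^sup>2) + (v i)\<^sup>2"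
    using insert by (simp add: sign_avg_add sign_avg_cmult sign_avg_const)
  finally show ?case using insert.hyps by simp
qed simp

text \<open>Averaging over a new sign cancels the odd powers. Raising the coefficient of
  \<open>v i ^ 4\<close> from 1 to 3 completes the square; 3 is the fourth moment of a standard
  Gaussian.\<close>

lemma sign_avg_power4_le:
  "finite A \<Longrightarrow> sign_avg v A (\<lambda>s. s ^ 4) \<le> 3 * (\<Sum>i\<in>A. (v i)\<^sup>2)\<^sup>2"
proof (induction A rule: finite_induct)
  case (insert i A)
  let ?q = "\<Sum>i\<in>A. (v i)\<^sup>2"
  have eq: "(s + v i) ^ 4 + (s - v i) ^ 4 = 2 * s ^ 4 + (12 * (v i)\<^sup>2 * s\<^sup>2 + 2 * v i ^ 4)" for s
    by algebra
  have v4: "0 \<le> v i ^ 4" by simp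
  have "sign_avg v (insert i A) (\<lambda>s. s ^ 4)
      = (sign_avg v A (\<lambda>s. (s + v i) ^ 4) + sign_avg v A (\<lambda>s. (s - v i) ^ 4)) / 2"
    using insert.hyps by (rule sign_avg_insert)
  also have "\<dots> = sign_avg v A (\<lambda>s. 2 * s ^ 4 + (12 * (v i)\<^sup>2 * s\<^sup>2 + 2 * v i ^ 4)) / 2"
    unfolding sign_avg_add[symmetric] eq ..
  also have "\<dots> = sign_avg v A (\<lambda>s. s ^ 4) + 6 * (v i)\<^sup>2 * ?q + v i ^ 4"
    using insert.hyps by (simp add: sign_avg_add sign_avg_cmult sign_avg_const sign_avg_power2)
  also have "\<dots> \<le> 3 * ?q\<^sup>2 + 6 * (v i)\<^sup>2 * ?q + 3 * v i ^ 4"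
    using insert.IH v4 by linarith
  also have "\<dots> = 3 * (?q + (v i)\<^sup>2)\<^sup>2"
    by algebra
  finally show ?case using insert.hyps by (simp add: add.commute)
qed simp

section \<open>Tail bounds by moments, symmetry and counting\<close>

definition tail :: "('i \<Rightarrow> real) \<Rightarrow> 'i set \<Rightarrow> real \<Rightarrow> real" where
  "tail v A t = sign_avg v A (\<lambda>s. of_bool (s > t))"

text \<open>Here \<open>m\<close> is the partial sum reached so far, so this is the conditional
  probability that the full sum ends outside \<open>[-1, 1]\<close>.\<close>

definition miss :: "('i \<Rightarrow> real) \<Rightarrow> 'i set \<Rightarrow> real \<Rightarrow> real" where
  "miss v A m = sign_avg v A (\<lambda>s. of_bool (\<bar>m + s\<bar> > 1))"

lemma tail_minus:
  assumes "finite A"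
  shows "sign_avg v A (\<lambda>s. of_bool (- s > t)) = tail v A t"
  using sign_avg_minus[OF assms, of v "\<lambda>s. of_bool (s > t)"] by (simp add: tail_def)

text \<open>Markov's inequality, with a factor 2 gained because both symmetric tails lie below the
  same even function.\<close>

lemma tail_le_even:
  assumes "finite A" "t > 0" "\<And>s. g (- s) = g s" "\<And>s. 0 \<le> g s" "\<And>s. s > t \<Longrightarrow> 1 \<le> g s"
  shows "tail v A t \<le> sign_avg v A g / 2"
proof -
  have "tail v A t + tail v A t
      = sign_avg v A (\<lambda>s. of_bool (s > t) + of_bool (- s > t))"
    using tail_minus[OF assms(1), of v t] by (simp only: sign_avg_add tail_def)
  also have "\<dots> \<le> sign_avg v A g"
  proof (rule sign_avg_mono)
    fix s
    show "of_bool (s > t) + of_bool (- s > t) \<le> g s"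
      using assms(2) assms(3,4)[of s] assms(5)[of s] assms(5)[of "- s"] by (auto simp: of_bool_def)
  qed
  finally show ?thesis by simp
qed

lemma tail_chebyshev:
  assumes "finite A" "t > 0"
  shows "tail v A t \<le> (\<Sum>i\<in>A. (v i)\<^sup>2) / (2 * t\<^sup>2)"
proof -
  have "tail v A t \<le> sign_avg v A (\<lambda>s. inverse (t\<^sup>2) * s\<^sup>2) / 2"
    by (rule tail_le_even)
      (use assms in \<open>auto simp: field_simps intro!: power_mono\<close>)
  also have "\<dots> = inverse (t\<^sup>2) * (\<Sum>i\<in>A. (v i)\<^sup>2) / 2"
    using assms by (simp add: sign_avg_cmult sign_avg_power2)
  finally show ?thesis by (simp add: field_simps)
qed

lemma tail_fourth_moment:
  assumes "finite A" "t > 0"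
  shows "tail v A t \<le> 3 * (\<Sum>i\<in>A. (v i)\<^sup>2)\<^sup>2 / (2 * t ^ 4)"
proof -
  have "tail v A t \<le> sign_avg v A (\<lambda>s. inverse (t ^ 4) * s ^ 4) / 2"
    by (rule tail_le_even)
      (use assms in \<open>auto simp: field_simps intro!: power_mono\<close>)
  also have "\<dots> = inverse (t ^ 4) * sign_avg v A (\<lambda>s. s ^ 4) / 2"
    by (simp add: sign_avg_cmult)
  also have "\<dots> \<le> inverse (t ^ 4) * (3 * (\<Sum>i\<in>A. (v i)\<^sup>2)\<^sup>2) / 2"
    using assms by (intro divide_right_mono mult_left_mono sign_avg_power4_le) auto
  finally show ?thesis by (simp add: field_simps)
qed

lemma miss_uminus:
  assumes "finite A"
  shows "miss v A (- m) = miss v A m"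
proof -
  have "\<bar>- m + - s\<bar> = \<bar>m + s\<bar>" for s :: real
    by linarith
  then show ?thesis
    using sign_avg_minus[OF assms, of v "\<lambda>s. of_bool (\<bar>- m + s\<bar> > 1)"]
    unfolding miss_def by simp
qed

lemma miss_insert:
  assumes "finite A" "i \<notin> A"
  shows "miss v (insert i A) m = (miss v A (m + v i) + miss v A (m - v i)) / 2"
  using assms by (simp add: miss_def sign_avg_insert algebra_simps)

text \<open>For \<open>0 \<le> m \<le> 1\<close>, leaving on the right needs a positive remainder,
  which by symmetry has probability at most 1/2. Leaving on the left needs the remainder to be below
  \<open>-(1 + m)\<close>.\<close>

lemma miss_le_half_plus_tail:
  assumes "finite A" "0 \<le> m" "m \<le> 1"
  shows "miss v A m \<le> 1 / 2 + tail v A (1 + m)"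
proof -
  have "tail v A 0 + tail v A 0 = sign_avg v A (\<lambda>s. of_bool (s > 0) + of_bool (- s > 0))"
    using tail_minus[OF assms(1), of v 0] by (simp only: sign_avg_add tail_def)
  also have "\<dots> \<le> sign_avg v A (\<lambda>s. 1)"
    by (rule sign_avg_mono) (auto simp: of_bool_def)
  finally have half: "tail v A 0 \<le> 1 / 2"
    using assms by (simp add: sign_avg_const)
  have "miss v A m \<le> sign_avg v A (\<lambda>s. of_bool (s > 0) + of_bool (- s > 1 + m))"
    unfolding miss_def by (rule sign_avg_mono) (use assms in \<open>auto simp: of_bool_def\<close>)
  also have "\<dots> = tail v A 0 + tail v A (1 + m)"
    using tail_minus[OF assms(1), of v "1 + m"] by (simp only: sign_avg_add tail_def)
  finally show ?thesis using half by simp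
qed

text \<open>Passing to \<open>\<bar>v i\<bar>\<close> does not change the average. Cauchy-Schwarz
  bounds the total of the absolute values by \<open>t + 2 J x\<close>, and each negative sign lowers
  it by at least \<open>2 x\<close>, so exceeding \<open>t\<close> allows fewer than
  \<open>J\<close> negative signs.\<close>

lemma tail_le_binomial:
  assumes "finite A" "\<And>i. i \<in> A \<Longrightarrow> x \<le> \<bar>v i\<bar>" "x \<ge> 0" "t \<ge> 0"
    and "real (card A) * (\<Sum>i\<in>A. (v i)\<^sup>2) \<le> (t + 2 * real J * x)\<^sup>2"
  shows "tail v A t \<le> real (\<Sum>j<J. card A choose j) / 2 ^ card A"
proof -
  let ?w = "\<lambda>i. \<bar>v i\<bar>"
  have "(sum ?w A)\<^sup>2 \<le> (\<Sum>i\<in>A. (?w i)\<^sup>2) * real (card A)"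
    by (rule sum_squared_le_sum_of_squares)
  also have "\<dots> \<le> (t + 2 * real J * x)\<^sup>2"
    using assms(5) by (simp add: mult.commute)
  finally have total: "sum ?w A \<le> t + 2 * real J * x"
    by (rule power2_le_imp_le) (use assms in auto)
  let ?few = "\<Union>j<J. {B. B \<subseteq> A \<and> card B = j}"
  have sub: "{B \<in> Pow A. sum ?w A - 2 * sum ?w B > t} \<subseteq> ?few"
  proof safe
    fix B assume B: "B \<subseteq> A" and gt: "sum ?w A - 2 * sum ?w B > t"
    have "real (card B) * x \<le> sum ?w B"
      using B assms(2) by (intro sum_bounded_below) auto
    with gt total have "2 * (real (card B) * x) < 2 * real J * x" by linarith
    then have "real (card B) * x < real J * x" by linarith
    then have "card B < J" using assms(3) by (simp add: mult_less_cancel_right)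
    then show "B \<in> ?few" using B by blast
  qed
  have "card {B \<in> Pow A. sum ?w A - 2 * sum ?w B > t} \<le> card ?few"
    using assms(1) sub by (intro card_mono) auto
  also have "\<dots> \<le> (\<Sum>j<J. card {B. B \<subseteq> A \<and> card B = j})"
    by (rule card_UN_le) simp
  also have "\<dots> = (\<Sum>j<J. card A choose j)"
    using assms(1) by (simp add: n_subsets)
  finally have "card {B \<in> Pow A. sum ?w A - 2 * sum ?w B > t} \<le> (\<Sum>j<J. card A choose j)" .
  moreover have "tail v A t = real (card {B \<in> Pow A. sum ?w A - 2 * sum ?w B > t}) / 2 ^ card A"
    unfolding tail_def sign_avg_abs[OF assms(1), of v, symmetric]
    using assms(1) by (simp add: sign_avg_def Int_def)
  ultimately show ?thesis
    by (simp add: divide_right_mono del: of_nat_sum)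
qed

section \<open>Backward induction along the stopped walk\<close>

text \<open>A step from \<open>m\<close> to \<open>m \<plusminus> v i\<close> preserves the mean of \<open>m\<^sup>2 - T\<close>, so a bound affine in
  \<open>m\<^sup>2 - T\<close> propagates backwards from the stopping states.\<close>

lemma miss_le_of_stopped:
  assumes "finite A"
    and stopped: "\<And>B m T. \<lbrakk>B \<subseteq> A; T\<^sub>0 \<le> T; T + (\<Sum>i\<in>B. (v i)\<^sup>2) \<le> 1; 0 \<le> m; m \<le> 1;
      \<And>i. i \<in> B \<Longrightarrow> 1 < m + \<bar>v i\<bar>\<rbrakk> \<Longrightarrow> miss v B m \<le> c + l * (m\<^sup>2 - T)"
    and "B \<subseteq> A" "T\<^sub>0 \<le> T" "T + (\<Sum>i\<in>B. (v i)\<^sup>2) \<le> 1" "\<bar>m\<bar> \<le> 1"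
  shows "miss v B m \<le> c + l * (m\<^sup>2 - T)"
  using assms(3-6)
proof (induction "card B" arbitrary: B m T rule: less_induct)
  case less
  have fin: "finite B" using less.prems assms(1) finite_subset by blast
  show ?case
  proof (cases "\<exists>i\<in>B. \<bar>m\<bar> + \<bar>v i\<bar> \<le> 1")
    case True
    then obtain i where i: "i \<in> B" "\<bar>m\<bar> + \<bar>v i\<bar> \<le> 1" by blast
    let ?B = "B - {i}"
    have sumB: "(\<Sum>i\<in>B. (v i)\<^sup>2) = (v i)\<^sup>2 + (\<Sum>i\<in>?B. (v i)\<^sup>2)"
      using fin i by (simp add: sum.remove)
    have step: "miss v ?B m' \<le> c + l * (m'\<^sup>2 - (T + (v i)\<^sup>2))" if "\<bar>m'\<bar> \<le> 1" for m'
    proof (rule less.hyps)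
      show "card ?B < card B" using fin i by (meson card_Diff1_less)
      show "?B \<subseteq> A" using less.prems by blast
      show "T\<^sub>0 \<le> T + (v i)\<^sup>2" using less.prems(2) zero_le_power2[of "v i"] by linarith
      show "T + (v i)\<^sup>2 + (\<Sum>i\<in>?B. (v i)\<^sup>2) \<le> 1" using less.prems(3) sumB by linarith
    qed (rule that)
    have "miss v B m = (miss v ?B (m + v i) + miss v ?B (m - v i)) / 2"
      using miss_insert[of ?B i v m] fin i by (simp add: insert_absorb)
    also have "\<dots> \<le> ((c + l * ((m + v i)\<^sup>2 - (T + (v i)\<^sup>2)))
        + (c + l * ((m - v i)\<^sup>2 - (T + (v i)\<^sup>2)))) / 2"
      using i by (intro divide_right_mono add_mono step) auto
    also have "\<dots> = c + l * (m\<^sup>2 - T)"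
      by (simp add: power2_eq_square field_simps)
    finally show ?thesis .
  next
    case False
    have "miss v B m = miss v B \<bar>m\<bar>"
      using miss_uminus[OF fin, of v m] by (simp add: abs_if)
    also have "\<dots> \<le> c + l * (\<bar>m\<bar>\<^sup>2 - T)"
      using False less.prems by (intro stopped) force+
    finally show ?thesis by simp
  qed
qed

section \<open>Bounds at the stopping states\<close>

text \<open>If terms remain, then \<open>m > 3/4\<close> and Chebyshev bounds the tail by
  \<open>8/49 (1 - T)\<close>. With \<open>m\<^sup>2\<close> replaced by 9/16 the claim is affine in
  \<open>T\<close>; slopes from about 0.1617 to 0.1652 satisfy it at both \<open>T = 0\<close> and
  \<open>T = 1\<close>.\<close>

lemma miss_stopped_small:
  assumes "finite B" "\<And>i. i \<in> B \<Longrightarrow> \<bar>v i\<bar> \<le> 1 / 4" "0 \<le> T" "T + (\<Sum>i\<in>B. (v i)\<^sup>2) \<le> 1"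
    and "0 \<le> m" "m \<le> 1" "\<And>i. i \<in> B \<Longrightarrow> 1 < m + \<bar>v i\<bar>"
  shows "miss v B m \<le> 5723 / 10000 + 165 / 1000 * (m\<^sup>2 - T)"
proof (cases "B = {}")
  case True
  then have "miss v B m = 0" "T \<le> 1"
    using assms by (auto simp: miss_def)
  then show ?thesis
    using zero_le_power2[of m] by argo
next
  case False
  then obtain i where "i \<in> B" by blast
  with assms have m: "3 / 4 \<le> m" by force
  have sq: "(3 / 4)\<^sup>2 \<le> m\<^sup>2" "(7 / 4)\<^sup>2 \<le> (1 + m)\<^sup>2"
    using m by (auto intro!: power_mono)
  have "tail v B (1 + m) \<le> (\<Sum>i\<in>B. (v i)\<^sup>2) / (2 * (1 + m)\<^sup>2)"
    using assms by (intro tail_chebyshev) auto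
  also have "\<dots> \<le> (1 - T) / (2 * (7 / 4)\<^sup>2)"
    using assms sq sum_nonneg[of B "\<lambda>i. (v i)\<^sup>2"] by (intro frac_le) auto
  finally have "tail v B (1 + m) \<le> (1 - T) * 8 / 49"
    by (simp add: power2_eq_square)
  moreover have "T \<le> 1"
    using assms sum_nonneg[of B "\<lambda>i. (v i)\<^sup>2"] by simp
  ultimately show ?thesis
    using miss_le_half_plus_tail[OF assms(1,5,6), of v] sq(1)[unfolded power_divide] assms(3)
    by simp argo
qed

lemma miss_stopped_near:
  assumes "finite B" "1 / 16 \<le> T" "T + (\<Sum>i\<in>B. (v i)\<^sup>2) \<le> 1" "3 / 4 \<le> m" "m \<le> 1"
  shows "miss v B m \<le> 5723 / 10000 + 1446 / 10000 * (m\<^sup>2 - T)"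
proof -
  let ?q = "\<Sum>i\<in>B. (v i)\<^sup>2"
  have q: "0 \<le> ?q" "?q \<le> 1 - T" "1 - T \<le> 15 / 16"
    using assms by (auto intro: sum_nonneg)
  have sq: "(3 / 4)\<^sup>2 \<le> m\<^sup>2" "(7 / 4) ^ 4 \<le> (1 + m) ^ 4"
    using assms by (auto intro!: power_mono)
  have "tail v B (1 + m) \<le> 3 * ?q\<^sup>2 / (2 * (1 + m) ^ 4)"
    using assms by (intro tail_fourth_moment) auto
  also have "\<dots> \<le> 3 * (15 / 16 * (1 - T)) / (2 * (7 / 4) ^ 4)"
  proof (intro frac_le mult_left_mono)
    \<comment> \<open>Bounding one factor by 15/16, available since \<open>T \<ge> 1/16\<close>,
      makes the fourth-moment bound linear in \<open>1 - T\<close>.\<close>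
    show "?q\<^sup>2 \<le> 15 / 16 * (1 - T)"
      unfolding power2_eq_square[of ?q] using q by (intro mult_mono) auto
  qed (use q sq in auto)
  also have "\<dots> = 360 / 2401 * (1 - T)"
    by (simp add: eval_nat_numeral)
  finally show ?thesis
    using miss_le_half_plus_tail[of B m v] sq(1)[unfolded power_divide] assms(1,2,4,5)
    by simp argo
qed

text \<open>Case analysis on the number \<open>N\<close> of remaining terms: many large terms leave
  little room for \<open>T\<close>, so \<open>T - m\<^sup>2\<close> turns negative and pays for a
  larger tail; with few terms the tail is tiny or zero.\<close>

lemma miss_stopped_far:
  assumes "finite B" "\<And>i. i \<in> B \<Longrightarrow> (v i)\<^sup>2 \<le> T" "T + (\<Sum>i\<in>B. (v i)\<^sup>2) \<le> 1"
    and "0 \<le> m" "m < 3 / 4" "\<And>i. i \<in> B \<Longrightarrow> 1 < m + \<bar>v i\<bar>"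
  shows "miss v B m \<le> 5723 / 10000 + 1446 / 10000 * (m\<^sup>2 - T)"
proof (cases "B = {}")
  case True
  then have "miss v B m = 0" "T \<le> 1"
    using assms by (auto simp: miss_def)
  then show ?thesis
    using zero_le_power2[of m] by argo
next
  case False
  define N where "N = card B"
  define x where "x = Min ((\<lambda>i. \<bar>v i\<bar>) ` B)"
  have N: "1 \<le> N"
    using False assms(1) by (simp add: N_def Suc_le_eq card_gt_0_iff)
  have xle: "x \<le> \<bar>v i\<bar>" if "i \<in> B" for i
    unfolding x_def using that assms(1) by simp
  have "x \<in> (\<lambda>i. \<bar>v i\<bar>) ` B"
    unfolding x_def using False assms(1) by (intro Min_in) auto
  then obtain k where "k \<in> B" "x = \<bar>v k\<bar>" by blast
  with assms(2,6) have x: "1 < m + x" "x\<^sup>2 \<le> T" by force+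
  then have x4: "1 / 4 < x" using assms(5) by linarith
  have "real N * x\<^sup>2 \<le> (\<Sum>i\<in>B. (v i)\<^sup>2)"
    unfolding N_def by (intro sum_bounded_below) (use xle x4 in \<open>auto simp: abs_le_square_iff[symmetric]\<close>)
  then have Nx: "real N * x\<^sup>2 \<le> 1 - T"
    using assms(3) by linarith
  have "0 \<le> real N * x\<^sup>2" by simp
  then have T1: "T \<le> 1" using Nx by linarith
  have "x\<^sup>2 \<le> 1\<^sup>2" using x(2) T1 by simp
  then have x1: "x \<le> 1" by (rule power2_le_imp_le) simp
  have x2: "1 / 16 \<le> x\<^sup>2"
    using power_mono[of "1/4" x 2] x4 by (simp add: power2_eq_square)
  have m2: "(1 - x)\<^sup>2 \<le> m\<^sup>2"
    using x x1 by (intro power_mono) auto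
  \<comment> \<open>The remaining terms take at least \<open>N x\<^sup>2\<close> of the budget, and
    stopping forces \<open>m > 1 - x\<close>. Allowing any \<open>k \<le> N\<close> lets one bound
    serve several values of \<open>N\<close>.\<close>
  have drift: "T - m\<^sup>2 \<le> 2 * x - (real k + 1) * x\<^sup>2" if "k \<le> N" for k
  proof -
    have "real k * x\<^sup>2 \<le> real N * x\<^sup>2" using that by (intro mult_right_mono) auto
    then show ?thesis using Nx m2 by (simp add: power2_eq_square algebra_simps)
  qed
  have count: "tail v B (1 + m) \<le> real (\<Sum>j<J. N choose j) / 2 ^ N"
    if "real N * (1 - T) \<le> (1 + m + 2 * real J * x)\<^sup>2" for J
    unfolding N_def
  proof (rule tail_le_binomial)
    have "real (card B) * (\<Sum>i\<in>B. (v i)\<^sup>2) \<le> real (card B) * (1 - T)"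
      using assms(3) by (intro mult_left_mono) auto
    then show "real (card B) * (\<Sum>i\<in>B. (v i)\<^sup>2) \<le> (1 + m + 2 * real J * x)\<^sup>2"
      using that N_def by simp
  qed (use assms xle x4 in auto)
  \<comment> \<open>\<open>J\<close> or more negative signs are impossible: \<open>1 + m + 2 J x > 2 + (2 J - 1) / 4\<close>,
    whereas \<open>N (1 - T) \<le> 15 N / 16\<close>.\<close>
  have few: "tail v B (1 + m) \<le> real (\<Sum>j<J. N choose j) / 2 ^ N"
    if J: "1 \<le> J" "15 * real N \<le> (7 + 2 * real J)\<^sup>2" for J
  proof (rule count)
    have "(2 * real J - 1) * (1 / 4) \<le> (2 * real J - 1) * x"
      using J x4 by (intro mult_left_mono) auto
    then have "(7 + 2 * real J) / 4 \<le> 1 + m + 2 * real J * x"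
      using x(1) by (simp add: algebra_simps)
    then have "((7 + 2 * real J) / 4)\<^sup>2 \<le> (1 + m + 2 * real J * x)\<^sup>2"
      by (intro power_mono) auto
    moreover have "real N * (1 - T) \<le> real N * (15 / 16)"
      using x(2) x2 by (intro mult_left_mono) auto
    ultimately show "real N * (1 - T) \<le> (1 + m + 2 * real J * x)\<^sup>2"
      using J(2) by (simp add: power_divide)
  qed
  have goal: ?thesis if "tail v B (1 + m) + 1446 / 10000 * (T - m\<^sup>2) \<le> 723 / 10000"
    using miss_le_half_plus_tail[of B m v] assms(1,4,5) that by simp argo
  \<comment> \<open>The slope 0.1446 is twice 0.0723, so this bound is exactly enough whenever the
    tail vanishes.\<close>
  have half: "T - m\<^sup>2 \<le> 1 / 2"
    using drift[OF N] zero_le_power2[of "2 * x - 1"] by (simp add: power2_eq_square algebra_simps)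
  have "N < 15"
  proof (rule ccontr)
    assume "\<not> N < 15"
    then have "15 * x\<^sup>2 \<le> real N * x\<^sup>2" by (intro mult_right_mono) auto
    moreover have "(1 / 4)\<^sup>2 < x\<^sup>2" using x4 by (intro power_strict_mono) auto
    ultimately show False using Nx x(2) by (simp add: power2_eq_square)
  qed
  then have "N \<le> 3 \<or> N = 4 \<or> N = 5 \<or> N = 6 \<or> (N = 7 \<or> N = 8)
    \<or> (N = 9 \<or> N = 10 \<or> N = 11) \<or> (N = 12 \<or> N = 13 \<or> N = 14)"
    by presburger
  then consider "N \<le> 3" | "N = 4" | "N = 5" | "N = 6" | "N = 7 \<or> N = 8"
    | "N = 9 \<or> N = 10 \<or> N = 11" | "N = 12 \<or> N = 13 \<or> N = 14"
    by blast
  then show ?thesis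
  proof cases
    case 1
    \<comment> \<open>The aim is the counting bound with \<open>J = 0\<close>: the absolute values
      total at most \<open>1 + m\<close>, so the tail is zero.\<close>
    have "real N * (1 - T) \<le> 3 * (1 - T)"
      using 1 T1 by (intro mult_right_mono) auto
    also have "\<dots> \<le> 3 * (1 - x\<^sup>2)" using x(2) by simp
    also have "\<dots> \<le> (2 - x)\<^sup>2"
      using zero_le_power2[of "2 * x - 1"] by (simp add: power2_eq_square algebra_simps)
    also have "\<dots> \<le> (1 + m)\<^sup>2" using x x1 by (intro power_mono) auto
    finally have "tail v B (1 + m) \<le> 0" using count[of 0] by simp
    then show ?thesis using half by (intro goal) argo
  next
    case 2
    show ?thesis
    proof (cases "4 * (1 - T) \<le> (1 + m)\<^sup>2")
      case True
      then have "tail v B (1 + m) \<le> 0" using count[of 0] 2 by simp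
      then show ?thesis using half by (intro goal) argo
    next
      case False
      have "tail v B (1 + m) \<le> 1 / 16" using few[of 1] 2 by simp
      \<comment> \<open>Two upper bounds for \<open>T\<close> are available:
        \<open>1 - (1 + m)\<^sup>2 / 4\<close> from the failed test, and
        \<open>1 - 4 (1 - m)\<^sup>2\<close> from the sizes of the terms. Both equal
        \<open>m\<^sup>2\<close> at \<open>m = 3/5\<close>, hence the split there.\<close>
      moreover have "T \<le> m\<^sup>2"
      proof (cases "3 / 5 \<le> m")
        case True
        then have "0 \<le> (5 * m - 3) * (m + 1)" by (intro mult_nonneg_nonneg) auto
        then show ?thesis using False by (simp add: power2_eq_square algebra_simps)
      next
        case m: False
        then have "0 \<le> (3 - 5 * m) * (1 - m)" by (intro mult_nonneg_nonneg) auto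
        moreover have "(1 - m)\<^sup>2 \<le> x\<^sup>2" using x assms by (intro power_mono) auto
        ultimately show ?thesis using Nx 2 by (simp add: power2_eq_square algebra_simps)
      qed
      ultimately show ?thesis by (intro goal) argo
    qed
  next
    case 3
    have "T - m\<^sup>2 \<le> 1 / 6"
      using drift[of 5] 3 zero_le_power2[of "6 * x - 1"] by (simp add: power2_eq_square algebra_simps)
    moreover have "tail v B (1 + m) \<le> 1 / 32" using few[of 1] 3 by simp
    ultimately show ?thesis by (intro goal) argo
  next
    case 4
    \<comment> \<open>\<open>few\<close> with \<open>J = 1\<close> just fails here, as
      \<open>90 > 81\<close>, so its underlying condition is tested directly. Its failure makes
      \<open>T\<close> small enough to pay for \<open>J = 2\<close>.\<close>
    show ?thesis
    proof (cases "6 * (1 - T) \<le> (1 + m + 2 * x)\<^sup>2")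
      case True
      then have "tail v B (1 + m) \<le> 1 / 64" using count[of 1] 4 by simp
      moreover have "T - m\<^sup>2 \<le> 1 / 7"
        using drift[of 6] 4 zero_le_power2[of "7 * x - 1"] by (simp add: power2_eq_square algebra_simps)
      ultimately show ?thesis by (intro goal) argo
    next
      case False
      have "(3 - m)\<^sup>2 \<le> (1 + m + 2 * x)\<^sup>2" using x assms by (intro power_mono) auto
      then have "T - m\<^sup>2 \<le> - (2 / 7)"
        using False zero_le_power2[of "7 * m - 3"] by (simp add: power2_eq_square algebra_simps)
      moreover have "tail v B (1 + m) \<le> 7 / 64"
        using few[of 2] 4 by (simp add: numeral_2_eq_2)
      ultimately show ?thesis by (intro goal) argo
    qed
  next
    case 5
    \<comment> \<open>This is \<open>2 x - 8 x\<^sup>2 \<le> 0\<close>. \<open>J = 2\<close> reaches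
      up to \<open>N = 8\<close> since \<open>120 \<le> 121\<close>; the tail bound is largest at
      \<open>N = 7\<close>.\<close>
    have "0 \<le> x * (4 * x - 1)" using x4 by (intro mult_nonneg_nonneg) auto
    then have "T - m\<^sup>2 \<le> 0"
      using drift[of 7] 5 by (auto simp: power2_eq_square algebra_simps)
    moreover have "tail v B (1 + m) \<le> 1 / 16"
      using few[of 2] 5 by (auto simp: lessThan_nat_numeral)
    ultimately show ?thesis by (intro goal) argo
  next
    case 6
    \<comment> \<open>This is \<open>2 x - 10 x\<^sup>2 \<le> -1/8\<close>, with equality at
      \<open>x = 1/4\<close>. The value 46/512 below belongs to \<open>N = 9\<close>, the worst
      case.\<close>
    have "0 \<le> (4 * x - 1) * (20 * x + 1)" using x4 by (intro mult_nonneg_nonneg) auto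
    then have "T - m\<^sup>2 \<le> - (1 / 8)"
      using drift[of 9] 6 by (auto simp: power2_eq_square algebra_simps)
    moreover have "tail v B (1 + m) \<le> 46 / 512"
      using few[of 3] 6 by (auto simp: eval_nat_numeral)
    ultimately show ?thesis by (intro goal) argo
  next
    case 7
    have "0 \<le> (4 * x - 1) * (20 * x + 1)" using x4 by (intro mult_nonneg_nonneg) auto
    then have "T - m\<^sup>2 \<le> - (1 / 8)"
      using drift[of 9] 7 by (auto simp: power2_eq_square algebra_simps)
    \<comment> \<open>The true maximum is 299/4096, at \<open>N = 12\<close>; the weaker constant of
      the previous case still suffices.\<close>
    moreover have "tail v B (1 + m) \<le> 46 / 512"
      using few[of 4] 7 by (auto simp: eval_nat_numeral)
    ultimately show ?thesis by (intro goal) argo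
  qed
qed

section \<open>Choice of the first term and the bound for the whole sum\<close>

lemma miss_zero_le:
  assumes "finite A" "(\<Sum>i\<in>A. (v i)\<^sup>2) \<le> 1"
  shows "miss v A 0 \<le> 5723 / 10000"
proof (cases "\<forall>i\<in>A. \<bar>v i\<bar> \<le> 1 / 4")
  case True
  have "miss v A 0 \<le> 5723 / 10000 + 165 / 1000 * (0\<^sup>2 - 0)"
  proof (rule miss_le_of_stopped[OF assms(1)])
    fix B m T
    assume *: "B \<subseteq> A" "0 \<le> T" "T + (\<Sum>i\<in>B. (v i)\<^sup>2) \<le> 1" "0 \<le> m" "m \<le> 1"
      "\<And>i. i \<in> B \<Longrightarrow> 1 < m + \<bar>v i\<bar>"
    show "miss v B m \<le> 5723 / 10000 + 165 / 1000 * (m\<^sup>2 - T)"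
      by (rule miss_stopped_small) (use * True assms(1) finite_subset in auto)
  qed (use assms in auto)
  then show ?thesis by simp
next
  case False
  then have "Max ((\<lambda>i. \<bar>v i\<bar>) ` A) \<in> (\<lambda>i. \<bar>v i\<bar>) ` A"
    using assms(1) by (intro Max_in) auto
  then obtain k where k: "k \<in> A" "\<bar>v k\<bar> = Max ((\<lambda>i. \<bar>v i\<bar>) ` A)" by auto
  then have max: "\<bar>v i\<bar> \<le> \<bar>v k\<bar>" if "i \<in> A" for i
    using assms(1) that by simp
  with False have "1 / 4 \<le> \<bar>v k\<bar>" by force
  then have k16: "1 / 16 \<le> (v k)\<^sup>2"
    using power_mono[of "1/4" "\<bar>v k\<bar>" 2] by (simp add: power2_eq_square)
  let ?A = "A - {k}"
  have sumA: "(v k)\<^sup>2 + (\<Sum>i\<in>?A. (v i)\<^sup>2) \<le> 1"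
    using assms k(1) by (simp add: sum.remove)
  have "(v k)\<^sup>2 \<le> 1"
    using sumA sum_nonneg[of ?A "\<lambda>i. (v i)\<^sup>2"] by simp
  then have k1: "\<bar>v k\<bar> \<le> 1"
    by (simp add: abs_square_le_1)
  have step: "miss v ?A m \<le> 5723 / 10000 + 1446 / 10000 * (m\<^sup>2 - (v k)\<^sup>2)" if "\<bar>m\<bar> \<le> 1" for m
  proof (rule miss_le_of_stopped)
    fix B m T
    assume *: "B \<subseteq> ?A" "(v k)\<^sup>2 \<le> T" "T + (\<Sum>i\<in>B. (v i)\<^sup>2) \<le> 1" "0 \<le> m" "m \<le> 1"
      "\<And>i. i \<in> B \<Longrightarrow> 1 < m + \<bar>v i\<bar>"
    have fin: "finite B" using *(1) assms(1) finite_subset by blast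
    show "miss v B m \<le> 5723 / 10000 + 1446 / 10000 * (m\<^sup>2 - T)"
    proof (cases "3 / 4 \<le> m")
      case True
      then show ?thesis using fin * k16 by (intro miss_stopped_near) auto
    next
      case False
      have "(v i)\<^sup>2 \<le> T" if "i \<in> B" for i
      proof -
        have "(v i)\<^sup>2 \<le> (v k)\<^sup>2"
          using max[of i] that *(1) by (auto simp: abs_le_square_iff[symmetric])
        then show ?thesis using *(2) by simp
      qed
      then show ?thesis using fin * False by (intro miss_stopped_far) auto
    qed
  qed (use assms sumA that in auto)
  have "miss v A 0 = (miss v ?A (v k) + miss v ?A (- v k)) / 2"
    using miss_insert[of ?A k v 0] assms(1) k(1) by (simp add: insert_absorb)
  \<comment> \<open>After the first step \<open>m\<^sup>2 = T\<close>, so the martingale term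
    vanishes for both signs.\<close>
  then show ?thesis using step[of "v k"] step[of "- v k"] k1 by simp
qed

section \<open>From independent random signs to sign averages\<close>

context prob_space
begin

lemma prob_random_sign:
  assumes "random_sign M X"
  shows "prob {\<omega> \<in> space M. X \<omega> = 1} = 1 / 2" "prob {\<omega> \<in> space M. X \<omega> = - 1} = 1 / 2"
proof -
  have X [measurable]: "X \<in> borel_measurable M"
    and eq: "distr M borel X = distr (uniform_count_measure {-1, 1}) borel (\<lambda>x. x)"
    using assms by (auto simp: random_sign_def)
  have "prob {\<omega> \<in> space M. X \<omega> = c} = 1 / 2" if c: "c \<in> {-1, 1}" for c
  proof -
    have "prob {\<omega> \<in> space M. X \<omega> = c} = measure (distr M borel X) {c}"
      by (subst measure_distr) (auto intro!: arg_cong[where f = prob])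
    also have "\<dots> = measure (uniform_count_measure {-1, 1 :: real}) {c}"
      unfolding eq using c
      by (subst measure_distr)
        (auto simp: space_uniform_count_measure sets_uniform_count_measure measurable_def
           intro!: arg_cong[where f = "measure _"])
    also have "\<dots> = 1 / 2"
      using c by (subst measure_uniform_count_measure) auto
    finally show ?thesis .
  qed
  then show "prob {\<omega> \<in> space M. X \<omega> = 1} = 1 / 2" "prob {\<omega> \<in> space M. X \<omega> = - 1} = 1 / 2"
    by auto
qed

lemma AE_random_sign:
  assumes "random_sign M X"
  shows "AE \<omega> in M. X \<omega> = 1 \<or> X \<omega> = - 1"
proof -
  have [measurable]: "X \<in> borel_measurable M"
    using assms by (auto simp: random_sign_def)
  have "prob {\<omega> \<in> space M. X \<omega> = 1 \<or> X \<omega> = - 1}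
      = prob ({\<omega> \<in> space M. X \<omega> = 1} \<union> {\<omega> \<in> space M. X \<omega> = - 1})"
    by (intro arg_cong[where f = prob]) auto
  also have "\<dots> = 1"
    using prob_random_sign[OF assms] by (subst finite_measure_Union) auto
  finally show ?thesis
    by (subst (asm) prob_Collect_eq_1) auto
qed

text \<open>Fixing the sign \<open>a i\<close> translates the event by \<open>v i\<close> or
  \<open>- v i\<close>, so the induction runs over all Borel sets \<open>E\<close>; independence of
  \<open>a i\<close> from the other terms supplies the factor 1/2.\<close>

lemma prob_signed_sum:
  assumes "finite A" "\<And>i. i \<in> A \<Longrightarrow> random_sign M (a i)" "indep_vars (\<lambda>_. borel) a A"
    and "E \<in> sets borel"
  shows "prob {\<omega> \<in> space M. (\<Sum>i\<in>A. a i \<omega> * v i) \<in> E} = sign_avg v A (\<lambda>s. of_bool (s \<in> E))"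
  using assms
proof (induction A arbitrary: E rule: finite_induct)
  case empty
  then show ?case by (simp add: prob_space)
next
  case (insert i A)
  let ?S = "\<lambda>\<omega>. \<Sum>j\<in>A. a j \<omega> * v j"
  have [measurable]: "a j \<in> borel_measurable M" if "j \<in> insert i A" for j
    using insert.prems(1)[OF that] by (simp add: random_sign_def)
  have [measurable]: "?S \<in> borel_measurable M"
    by measurable
  have [measurable]: "E \<in> sets borel" by fact
  have indepA: "indep_vars (\<lambda>_. borel) a A"
    using insert.prems(2) by (rule indep_vars_subset) auto
  have indep: "indep_var borel (a i) borel ?S"
  proof -
    have "indep_var borel ((\<lambda>f. f i) \<circ> (\<lambda>\<omega>. restrict (\<lambda>j. a j \<omega>) {i}))
        borel ((\<lambda>f. \<Sum>j\<in>A. f j * v j) \<circ> (\<lambda>\<omega>. restrict (\<lambda>j. a j \<omega>) A))"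
      using insert.hyps insert.prems
      by (intro indep_var_compose[OF indep_var_restrict[OF insert.prems(2)]]) auto
    also have "((\<lambda>f. f i) \<circ> (\<lambda>\<omega>. restrict (\<lambda>j. a j \<omega>) {i})) = a i"
      by auto
    also have "((\<lambda>f. \<Sum>j\<in>A. f j * v j) \<circ> (\<lambda>\<omega>. restrict (\<lambda>j. a j \<omega>) A)) = ?S"
      by (auto simp: fun_eq_iff)
    finally show ?thesis .
  qed
  have part: "prob {\<omega> \<in> space M. a i \<omega> = c \<and> ?S \<omega> + c * v i \<in> E}
      = sign_avg v A (\<lambda>s. of_bool (s + c * v i \<in> E)) / 2" if c: "c \<in> {-1, 1}" for c
  proof -
    have E': "{s. s + c * v i \<in> E} \<in> sets borel"
      by measurable
    have "prob {\<omega> \<in> space M. a i \<omega> = c \<and> ?S \<omega> + c * v i \<in> E}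
        = prob ((\<lambda>\<omega>. (a i \<omega>, ?S \<omega>)) -` ({c} \<times> {s. s + c * v i \<in> E}) \<inter> space M)"
      by (intro arg_cong[where f = prob]) auto
    also have "\<dots> = prob (a i -` {c} \<inter> space M) * prob (?S -` {s. s + c * v i \<in> E} \<inter> space M)"
      using E' by (intro indep_varD[OF indep]) auto
    also have "a i -` {c} \<inter> space M = {\<omega> \<in> space M. a i \<omega> = c}" by auto
    also have "prob \<dots> = 1 / 2"
      using c prob_random_sign[OF insert.prems(1)[of i]] by auto
    also have "?S -` {s. s + c * v i \<in> E} \<inter> space M
        = {\<omega> \<in> space M. ?S \<omega> \<in> {s. s + c * v i \<in> E}}" by auto
    also have "prob \<dots> = sign_avg v A (\<lambda>s. of_bool (s \<in> {s. s + c * v i \<in> E}))"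
      using insert.prems indepA E' by (intro insert.IH) auto
    finally show ?thesis by simp
  qed
  have "prob {\<omega> \<in> space M. (\<Sum>j\<in>insert i A. a j \<omega> * v j) \<in> E}
      = prob ({\<omega> \<in> space M. a i \<omega> = 1 \<and> ?S \<omega> + 1 * v i \<in> E}
          \<union> {\<omega> \<in> space M. a i \<omega> = - 1 \<and> ?S \<omega> + - 1 * v i \<in> E})"
  \<comment> \<open>The two events agree only almost surely, because a random sign may take other
    values on a null set.\<close>
  proof (rule finite_measure_eq_AE)
    show "AE \<omega> in M. \<omega> \<in> {\<omega> \<in> space M. (\<Sum>j\<in>insert i A. a j \<omega> * v j) \<in> E}
      \<longleftrightarrow> \<omega> \<in> {\<omega> \<in> space M. a i \<omega> = 1 \<and> ?S \<omega> + 1 * v i \<in> E}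
          \<union> {\<omega> \<in> space M. a i \<omega> = - 1 \<and> ?S \<omega> + - 1 * v i \<in> E}"
      using AE_random_sign[OF insert.prems(1)[of i, simplified]]
      by eventually_elim (use insert.hyps in \<open>auto simp: add.commute\<close>)
  qed measurable
  also have "\<dots> = prob {\<omega> \<in> space M. a i \<omega> = 1 \<and> ?S \<omega> + 1 * v i \<in> E}
      + prob {\<omega> \<in> space M. a i \<omega> = - 1 \<and> ?S \<omega> + - 1 * v i \<in> E}"
    by (intro finite_measure_Union) (measurable, auto)
  finally show ?case
    using part[of 1] part[of "- 1"] insert.hyps by (simp add: sign_avg_insert)
qed

end

theorem mainTheorem1:
  fixes M :: "'a measure"
    and n :: nat
    and v :: "nat \<Rightarrow> real"
    and a :: "nat \<Rightarrow> 'a \<Rightarrow> real"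
  assumes "prob_space M"
    and "(\<Sum>i=1..n. (v i)\<^sup>2) \<le> 1"
    and "\<And>i. i \<in> {1..n} \<Longrightarrow> random_sign M (a i)"
    and "prob_space.indep_vars M (\<lambda>_. borel) a {1..n}"
  shows "\<P>(\<omega> in M. \<bar>\<Sum>i=1..n. a i \<omega> * v i\<bar> \<le> 1) > 0.427685"
proof -
  interpret prob_space M by fact
  have "prob {\<omega> \<in> space M. (\<Sum>i=1..n. a i \<omega> * v i) \<in> {s. \<bar>s\<bar> \<le> 1}}
      = sign_avg v {1..n} (\<lambda>s. of_bool (s \<in> {s. \<bar>s\<bar> \<le> 1}))"
    using assms(3,4) by (intro prob_signed_sum) auto
  then have hit: "\<P>(\<omega> in M. \<bar>\<Sum>i=1..n. a i \<omega> * v i\<bar> \<le> 1)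
      = sign_avg v {1..n} (\<lambda>s. of_bool (\<bar>s\<bar> \<le> 1))"
    by simp
  have "of_bool (\<bar>s\<bar> \<le> 1) + of_bool (\<bar>0 + s\<bar> > 1) = (1 :: real)" for s :: real
    by (auto simp: of_bool_def)
  then have "sign_avg v {1..n} (\<lambda>s. of_bool (\<bar>s\<bar> \<le> 1)) + miss v {1..n} 0 = 1"
    unfolding miss_def sign_avg_add[symmetric] by (simp add: sign_avg_const)
  \<comment> \<open>Numerically, \<open>1 - 0.5723 = 0.4277 > 0.427685\<close>.\<close>
  with hit miss_zero_le[of "{1..n}" v] assms(2) show ?thesis by simp
qed

end
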